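(* Let $v_{c_L}(x)=\sum_{k_1,k_2,k_3\in\mathcal K}p(\|x-b\mathbf k\|)$, $x\in\Omega_L$, $\mathbf k=(k_1,k_2,k_3)$, be the full lattice sum over $L^3$ cells of a single potential, and let $\mathbf V_{c_L}\in\mathbb R^{N_L\times N_L\times N_L}$ be its projected tensor, where $N_L=nL$ is the univariate grid size. (A) Let $$\widetilde{\mathbf P}_{L,R}=\sum_{q=1}^{R}\widetilde{\mathbf p}^{(1)}_q\otimes\widetilde{\mathbf p}^{(2)}_q\otimes\widetilde{\mathbf p}^{(3)}_q\in\mathbb R^{2N_L\times 2N_L\times 2N_L}$$ be a rank-$R$ canonical reference tensor approximating the potential $p(\|x\|)$. Then the projected tensor $\mathbf V_{c_L}$ of the interaction potential, representing the full lattice sum over $L^3$ cells, can be represented by the rank-$R$ canonical tensor $\mathbf P_{c_L}=\sum_{k_1,k_2,k_3\in\mathcal K}\mathcal W_{(\mathbf k)}\widetilde{\mathbf P}_{L,R}$, which has the form $$\mathbf P_{c_L}=\sum_{q=1}^{R}\Big(\sum_{k_1\in\mathcal K}\mathcal W_{(k_1)}\widetilde{\mathbf p}^{(1)}_q\Big)\otimes\Big(\sum_{k_2\in\mathcal K}\mathcal W_{(k_2)}\widetilde{\mathbf p}^{(2)}_q\Big)\otimes\Big(\sum_{k_3\in\mathcal K}\mathcal W_{(k_3)}\widetilde{\mathbf p}^{(3)}_q\Big).$$ The numerical cost and storage size are estimated by $O(R\,L\,N_L)$ and $O(R\,N_L)$, respectively. (B) Let $$\widetilde{\mathbf T}_{L,\mathbf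 r}=\sum_{\mathbf m=\mathbf 1}^{\mathbf r}b_{\mathbf m}\,\widetilde{\mathbf t}^{(1)}_{m_1}\otimes\widetilde{\mathbf t}^{(2)}_{m_2}\otimes\widetilde{\mathbf t}^{(3)}_{m_3}\in\mathbb R^{2N_L\times2N_L\times2N_L}$$ be a rank-$\mathbf r$ Tucker reference tensor, $\mathbf r=(r_1,r_2,r_3)$, approximating the potential $p(\|x\|)$. Then the rank-$\mathbf r$ Tucker approximation $\mathbf T_{c_L}=\sum_{k_1,k_2,k_3\in\mathcal K}\mathcal W_{(\mathbf k)}\widetilde{\mathbf T}_{L,\mathbf r}$ of the lattice-sum tensor $\mathbf V_{c_L}$ can be computed in the form $$\mathbf T_{c_L}=\sum_{\mathbf m=\mathbf 1}^{\mathbf r}b_{\mathbf m}\Big(\sum_{k_1\in\mathcal K}\mathcal W_{(k_1)}\widetilde{\mathbf t}^{(1)}_{m_1}\Big)\otimes\Big(\sum_{k_2\in\mathcal K}\mathcal W_{(k_2)}\widetilde{\mathbf t}^{(2)}_{m_2}\Big)\otimes\Big(\sum_{k_3\in\mathcal K}\mathcal W_{(k_3)}\widetilde{\mathbf t}^{(3)}_{m_3}\Big).$$ The numerical cost and storage size are estimated by $O(3r\,L\,N_L)$ and $O(3r\,N_L)$, respectively, where $r=\max_\ell r_\ell$.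
   Context: Lattice and grid. $p(\|x\|)$, $x\in\mathbb R^3$, is a spherically symmetric interaction kernel (e.g. $1/\|x\|$). $n\ge1$ is an integer, $h>0$ the mesh size, $b=nh$, and $L=2L_0$ is an even positive integer. $\mathcal K=\{-L/2,\dots,-1,0,1,\dots,L/2-1\}$. The box is $\Omega_L=[-bL/2,bL/2]^3$, a union of $L^3$ cells which are shifts by $b\mathbf k$, $\mathbf k\in\mathcal K^3$, of a cube of size $b\times b\times b$. It carries the uniform $N_L\times N_L\times N_L$ grid of mesh size $h$, $N_L=nL$. The auxiliary box $\widetilde\Omega_L=[-bL,bL]^3$ carries the uniform $2N_L\times2N_L\times2N_L$ grid of the same mesh size $h$. Projected tensor. The projected tensor of a function $f$ on a box with such a grid is the 3rd order tensor with entries $\int\psi_{\mathbf i}(x)f(x)\,dx$, where $\psi_{\mathbf i}(x)=\prod_{\ell=1}^3\psi^{(\ell)}_{i_\ell}(x_\ell)$ are the tensor-product piecewise constant basis functions associated with the grid cells. A reference tensor is a low-rank tensor of size $2N_L\times2N_L\times2N_L$ approximating the projected tensor of $p(\|x\|)$ (centered at the origin) on $\widetilde\Omega_L$. "Representing" or "approximating" $\mathbf V_{c_L}$ means that the projected tensor of each shifted potential $p(\|x-b\mathbf k\|)$ on $\Omega_L$ is replaced by the correspondingly shifted and windowed reference tensor. Shift-and-windowing operator. For $\mathbf k\in\mathcal K^3$, $\mathcal W_{(\mathbf k)}=\mathcal W_{(k_1)}\otimes\mathcal W_{(k_2)}\otimes\mathcal W_{(k_3)}:\mathbb R^{2N_L\times2N_L\times2N_L}\to\mathbb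 R^{N_L\times N_L\times N_L}$ is the rank-1 linear operator which shifts by the lattice vector $b\mathbf k$ and restricts to the $N_L\times N_L\times N_L$ grid of $\Omega_L$; in one dimension, $(\mathcal W_{(k)}\mathbf p)_i=\mathbf p_{\,i+N_L/2-kn}$, $i=1,\dots,N_L$, for $\mathbf p\in\mathbb R^{2N_L}$. Formats. A rank-$R$ canonical tensor is one given as a sum of $R$ rank-one tensors (outer products of vectors). A rank-$\mathbf r$ Tucker tensor is one given as $\sum_{\mathbf m=\mathbf 1}^{\mathbf r}b_{\mathbf m}\,\mathbf t^{(1)}_{m_1}\otimes\mathbf t^{(2)}_{m_2}\otimes\mathbf t^{(3)}_{m_3}$, the sum running over $\mathbf m=(m_1,m_2,m_3)$ with $1\le m_\ell\le r_\ell$, with core coefficients $b_{\mathbf m}$ and directional vectors $\mathbf t^{(\ell)}_{m}$; in this statement the vectors of the resulting sum are not required to be orthogonal. The numerical cost and storage size are those of the tensor representation of the lattice sum given in the respective part.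
   Formalization: In (B) the storage bound O(3rN_L) is proved for the directional vectors; with the r1·r2·r3 core coefficients included it is proved only when r² ≤ c·N_L (constant depending on c), since the r³ core entries exceed O(3rN_L) for general ranks. *)

theory Defs
  imports "HOL-Analysis.Analysis" "HOL-Library.Function_Algebras"
begin

text \<open>
  Entries are indexed from 1. The space of vectors of length \<open>N\<close> consists of the functions that
  vanish outside \<open>{1..N}\<close>, and likewise for \<open>N \<times> N \<times> N\<close> tensors, so that equality of functions is
  equality in these spaces. Sums of vectors and tensors are the pointwise ones of
  \<^theory>\<open>HOL-Library.Function_Algebras\<close>.
\<close>

type_synonym rvector = "nat \<Rightarrow> real"
type_synonym tensor3 = "nat \<Rightarrow> nat \<Rightarrow> nat \<Rightarrow> real"

definition vectors :: "nat \<Rightarrow> rvector set" where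
  "vectors N = {v. \<forall>i. i \<notin> {1..N} \<longrightarrow> v i = 0}"

definition outer :: "rvector \<Rightarrow> rvector \<Rightarrow> rvector \<Rightarrow> tensor3" where
  "outer u v w = (\<lambda>i1 i2 i3. u i1 * v i2 * w i3)"

definition tscale :: "real \<Rightarrow> tensor3 \<Rightarrow> tensor3" where
  "tscale c T = (\<lambda>i1 i2 i3. c * T i1 i2 i3)"

definition canonical_sum ::
  "nat \<Rightarrow> (nat \<Rightarrow> rvector) \<Rightarrow> (nat \<Rightarrow> rvector) \<Rightarrow> (nat \<Rightarrow> rvector) \<Rightarrow> tensor3" where
  "canonical_sum R u v w = (\<Sum>q=1..R. outer (u q) (v q) (w q))"

definition tucker_sum ::
  "nat \<Rightarrow> nat \<Rightarrow> nat \<Rightarrow> tensor3 \<Rightarrow> (nat \<Rightarrow> rvector) \<Rightarrow> (nat \<Rightarrow> rvector) \<Rightarrow> (nat \<Rightarrow> rvector) \<Rightarrow> tensor3"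
where
  "tucker_sum r1 r2 r3 b u v w =
     (\<Sum>m1=1..r1. \<Sum>m2=1..r2. \<Sum>m3=1..r3. tscale (b m1 m2 m3) (outer (u m1) (v m2) (w m3)))"

definition is_canonical :: "nat \<Rightarrow> nat \<Rightarrow> tensor3 \<Rightarrow> bool" where
  "is_canonical N R T \<longleftrightarrow>
     (\<exists>u v w. (\<forall>q\<in>{1..R}. u q \<in> vectors N \<and> v q \<in> vectors N \<and> w q \<in> vectors N)
       \<and> T = canonical_sum R u v w)"

definition is_tucker :: "nat \<Rightarrow> nat \<Rightarrow> nat \<Rightarrow> nat \<Rightarrow> tensor3 \<Rightarrow> bool" where
  "is_tucker N r1 r2 r3 T \<longleftrightarrow>
     (\<exists>b u v w. (\<forall>m\<in>{1..r1}. u m \<in> vectors N) \<and> (\<forall>m\<in>{1..r2}. v m \<in> vectors N)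
       \<and> (\<forall>m\<in>{1..r3}. w m \<in> vectors N) \<and> T = tucker_sum r1 r2 r3 b u v w)"

text \<open>Approximation of \<open>N \<times> N \<times> N\<close> tensors up to \<open>\<epsilon>\<close>, measured in the maximum norm.\<close>

definition approximates :: "nat \<Rightarrow> real \<Rightarrow> tensor3 \<Rightarrow> tensor3 \<Rightarrow> bool" where
  "approximates N \<epsilon> S T \<longleftrightarrow>
     (\<forall>i1\<in>{1..N}. \<forall>i2\<in>{1..N}. \<forall>i3\<in>{1..N}. \<bar>S i1 i2 i3 - T i1 i2 i3\<bar> \<le> \<epsilon>)"

definition lattice_index :: "nat \<Rightarrow> int set" where
  "lattice_index L = {- (int L div 2) .. int L div 2 - 1}"

definition lattice_vector :: "real \<Rightarrow> int \<Rightarrow> int \<Rightarrow> int \<Rightarrow> real^3" where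
  "lattice_vector b k1 k2 k3 = b *\<^sub>R vector [real_of_int k1, real_of_int k2, real_of_int k3]"

definition centered_box :: "real \<Rightarrow> (real^3) set" where
  "centered_box a = cbox (\<chi> l. - a) (\<chi> l. a)"

text \<open>
  Basis function of the \<open>i\<close>-th cell, \<open>i = 1, 2, \<dots>\<close>, of the uniform grid of mesh size \<open>h\<close> starting at
  \<open>- a\<close>. The cells are half open, so that they are disjoint.
\<close>

definition basis1 :: "real \<Rightarrow> real \<Rightarrow> nat \<Rightarrow> real \<Rightarrow> real" where
  "basis1 a h i = indicator {- a + (real i - 1) * h ..< - a + real i * h}"

definition basis3 :: "real \<Rightarrow> real \<Rightarrow> nat \<Rightarrow> nat \<Rightarrow> nat \<Rightarrow> real^3 \<Rightarrow> real" where
  "basis3 a h i1 i2 i3 x = basis1 a h i1 (x $ 1) * basis1 a h i2 (x $ 2) * basis1 a h i3 (x $ 3)"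

text \<open>
  Projected tensor of \<open>f\<close> on the box \<open>centered_box a\<close> with an \<open>N \<times> N \<times> N\<close> grid of mesh size \<open>h\<close>;
  it is used with \<open>N * h = 2 * a\<close>.
\<close>

definition projected_tensor :: "real \<Rightarrow> real \<Rightarrow> nat \<Rightarrow> (real^3 \<Rightarrow> real) \<Rightarrow> tensor3" where
  "projected_tensor a h N f = (\<lambda>i1 i2 i3.
     if i1 \<in> {1..N} \<and> i2 \<in> {1..N} \<and> i3 \<in> {1..N}
     then (\<integral>x. basis3 a h i1 i2 i3 x * f x \<partial>lborel) else 0)"

text \<open>
  In the following, \<open>b = n * h\<close> is the cell size and \<open>n * L\<close> the univariate grid size of the box
  \<open>[- b L / 2, b L / 2]\<^sup>3\<close>. Integrability of the kernel on the auxiliary box \<open>[- b L, b L]\<^sup>3\<close>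
  makes all projected tensors well defined.
\<close>

definition lattice_setting :: "(real \<Rightarrow> real) \<Rightarrow> nat \<Rightarrow> real \<Rightarrow> nat \<Rightarrow> bool" where
  "lattice_setting p n h L \<longleftrightarrow>
     n \<ge> 1 \<and> h > 0 \<and> L > 0 \<and> even L \<and>
     set_integrable lborel (centered_box (real n * h * real L)) (\<lambda>x. p (norm x))"

definition shifted_potential ::
  "(real \<Rightarrow> real) \<Rightarrow> real \<Rightarrow> int \<Rightarrow> int \<Rightarrow> int \<Rightarrow> real^3 \<Rightarrow> real" where
  "shifted_potential p b k1 k2 k3 x = p (norm (x - lattice_vector b k1 k2 k3))"

definition lattice_potential :: "(real \<Rightarrow> real) \<Rightarrow> real \<Rightarrow> nat \<Rightarrow> real^3 \<Rightarrow> real" where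
  "lattice_potential p b L x =
     (\<Sum>k1\<in>lattice_index L. \<Sum>k2\<in>lattice_index L. \<Sum>k3\<in>lattice_index L.
        shifted_potential p b k1 k2 k3 x)"

definition box_tensor :: "nat \<Rightarrow> real \<Rightarrow> nat \<Rightarrow> (real^3 \<Rightarrow> real) \<Rightarrow> tensor3" where
  "box_tensor n h L f = projected_tensor (real n * h * real L / 2) h (n * L) f"

definition aux_box_tensor :: "nat \<Rightarrow> real \<Rightarrow> nat \<Rightarrow> (real^3 \<Rightarrow> real) \<Rightarrow> tensor3" where
  "aux_box_tensor n h L f = projected_tensor (real n * h * real L) h (2 * (n * L)) f"

text \<open>For \<open>k \<in> lattice_index L\<close> and \<open>i \<in> {1..n * L}\<close> the accessed index lies in \<open>{1..2 * (n * L)}\<close>.\<close>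

definition window :: "nat \<Rightarrow> nat \<Rightarrow> int \<Rightarrow> rvector \<Rightarrow> rvector" where
  "window n L k p = (\<lambda>i.
     if i \<in> {1..n * L} then p (nat (int i + int (n * L) div 2 - k * int n)) else 0)"

text \<open>
  The tensor product \<open>A \<otimes> B \<otimes> C\<close> of linear operators on vectors: \<open>C\<close> acts on the third index,
  \<open>B\<close> on the second one, and \<open>A\<close> on the first one.
\<close>

definition tensor_op ::
  "(rvector \<Rightarrow> rvector) \<Rightarrow> (rvector \<Rightarrow> rvector) \<Rightarrow> (rvector \<Rightarrow> rvector) \<Rightarrow> tensor3 \<Rightarrow> tensor3" where
  "tensor_op A B C T =
     (\<lambda>i1 i2 i3. A (\<lambda>j1. B (\<lambda>j2. C (\<lambda>j3. T j1 j2 j3) i3) i2) i1)"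

definition window3 :: "nat \<Rightarrow> nat \<Rightarrow> int \<Rightarrow> int \<Rightarrow> int \<Rightarrow> tensor3 \<Rightarrow> tensor3" where
  "window3 n L k1 k2 k3 = tensor_op (window n L k1) (window n L k2) (window n L k3)"

text \<open>
  The tensor obtained from the lattice sum by replacing the projected tensor of every shifted
  potential by the shifted and windowed reference tensor \<open>S\<close>.
\<close>

definition assembled :: "nat \<Rightarrow> nat \<Rightarrow> tensor3 \<Rightarrow> tensor3" where
  "assembled n L S =
     (\<Sum>k1\<in>lattice_index L. \<Sum>k2\<in>lattice_index L. \<Sum>k3\<in>lattice_index L. window3 n L k1 k2 k3 S)"

text \<open>
  \<open>T\<close> represents the projected lattice sum by means of the reference tensor \<open>S\<close>, whose accuracy on the
  auxiliary box is \<open>\<epsilon>\<close>: the projected lattice sum is the sum of the projected tensors of the shifted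
  potentials; each of these is the shifted and windowed projected tensor of the centered potential;
  and \<open>T\<close> is the result of replacing each of them by the shifted and windowed \<open>S\<close>, which
  is a replacement with the accuracy of \<open>S\<close>. The errors of the \<open>L^3\<close> summands add up.
\<close>

definition represents_lattice_sum ::
  "(real \<Rightarrow> real) \<Rightarrow> nat \<Rightarrow> real \<Rightarrow> nat \<Rightarrow> real \<Rightarrow> tensor3 \<Rightarrow> tensor3 \<Rightarrow> bool" where
  "represents_lattice_sum p n h L \<epsilon> S T \<longleftrightarrow>
     box_tensor n h L (lattice_potential p (real n * h) L) =
       (\<Sum>k1\<in>lattice_index L. \<Sum>k2\<in>lattice_index L. \<Sum>k3\<in>lattice_index L.
          box_tensor n h L (shifted_potential p (real n * h) k1 k2 k3)) \<and>
     (\<forall>k1\<in>lattice_index L. \<forall>k2\<in>lattice_index L. \<forall>k3\<in>lattice_index L.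
        box_tensor n h L (shifted_potential p (real n * h) k1 k2 k3) =
          window3 n L k1 k2 k3 (aux_box_tensor n h L (\<lambda>x. p (norm x))) \<and>
        approximates (n * L) \<epsilon> (window3 n L k1 k2 k3 S)
          (box_tensor n h L (shifted_potential p (real n * h) k1 k2 k3))) \<and>
     T = assembled n L S \<and>
     approximates (n * L) (real L ^ 3 * \<epsilon>) T
       (box_tensor n h L (lattice_potential p (real n * h) L))"

text \<open>
  A computation returns its value together with the number of arithmetic operations on reals that it
  has performed. Reading an entry of a given vector and integer index arithmetic are free.
\<close>

type_synonym 'a counted = "'a \<times> nat"

definition creturn :: "'a \<Rightarrow> 'a counted" where
  "creturn x = (x, 0)"

definition cbind :: "'a counted \<Rightarrow> ('a \<Rightarrow> 'b counted) \<Rightarrow> 'b counted" where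
  "cbind m f = (fst (f (fst m)), snd m + snd (f (fst m)))"

definition cadd :: "real \<Rightarrow> real \<Rightarrow> real counted" where
  "cadd x y = (x + y, 1)"

primrec csum :: "real list \<Rightarrow> real counted" where
  "csum [] = creturn 0"
| "csum (x # xs) = cbind (csum xs) (\<lambda>s. cadd x s)"

primrec cmap :: "('a \<Rightarrow> 'b counted) \<Rightarrow> 'a list \<Rightarrow> 'b list counted" where
  "cmap f [] = creturn []"
| "cmap f (x # xs) = cbind (f x) (\<lambda>y. cbind (cmap f xs) (\<lambda>ys. creturn (y # ys)))"

definition compute_window_sum :: "nat \<Rightarrow> nat \<Rightarrow> rvector \<Rightarrow> real list counted" where
  "compute_window_sum n L v =
     cmap (\<lambda>i. csum (map (\<lambda>k. window n L k v i) [- (int L div 2) .. int L div 2 - 1])) [1..<n * L + 1]"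

text \<open>One list of arrays (the directional vectors) for each of the three directions.\<close>

type_synonym factors = "real list list \<times> real list list \<times> real list list"

definition compute_factors ::
  "nat \<Rightarrow> nat \<Rightarrow> nat \<Rightarrow> nat \<Rightarrow> nat \<Rightarrow> (nat \<Rightarrow> rvector) \<Rightarrow> (nat \<Rightarrow> rvector) \<Rightarrow> (nat \<Rightarrow> rvector)
     \<Rightarrow> factors counted" where
  "compute_factors n L r1 r2 r3 u v w =
     cbind (cmap (\<lambda>m. compute_window_sum n L (u m)) [1..<r1 + 1]) (\<lambda>us.
     cbind (cmap (\<lambda>m. compute_window_sum n L (v m)) [1..<r2 + 1]) (\<lambda>vs.
     cbind (cmap (\<lambda>m. compute_window_sum n L (w m)) [1..<r3 + 1]) (\<lambda>ws.
     creturn (us, vs, ws))))"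

definition vector_of :: "real list \<Rightarrow> rvector" where
  "vector_of xs = (\<lambda>i. if i \<in> {1..length xs} then xs ! (i - 1) else 0)"

definition factor_of :: "real list list \<Rightarrow> nat \<Rightarrow> rvector" where
  "factor_of xss m = vector_of (xss ! (m - 1))"

definition number_of_factors :: "factors \<Rightarrow> nat \<times> nat \<times> nat" where
  "number_of_factors F = (case F of (us, vs, ws) \<Rightarrow> (length us, length vs, length ws))"

definition canonical_value :: "nat \<Rightarrow> factors \<Rightarrow> tensor3" where
  "canonical_value R F = (case F of (us, vs, ws) \<Rightarrow>
     canonical_sum R (factor_of us) (factor_of vs) (factor_of ws))"

definition tucker_value :: "nat \<Rightarrow> nat \<Rightarrow> nat \<Rightarrow> tensor3 \<Rightarrow> factors \<Rightarrow> tensor3" where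
  "tucker_value r1 r2 r3 b F = (case F of (us, vs, ws) \<Rightarrow>
     tucker_sum r1 r2 r3 b (factor_of us) (factor_of vs) (factor_of ws))"

text \<open>
  The number of reals stored in the directional vectors. For a Tucker tensor this does not include the
  \<open>r1 * r2 * r3\<close> core coefficients; in the lattice sum they are those of the reference tensor.
\<close>

definition factor_storage :: "factors \<Rightarrow> nat" where
  "factor_storage F = (case F of (us, vs, ws) \<Rightarrow>
     sum_list (map length us) + sum_list (map length vs) + sum_list (map length ws))"

definition tucker_storage :: "nat \<Rightarrow> nat \<Rightarrow> nat \<Rightarrow> factors \<Rightarrow> nat" where
  "tucker_storage r1 r2 r3 F = r1 * r2 * r3 + factor_storage F"

end

theory Submission
  imports Defs
begin

text \<open>
  The two closed forms hold because every shift-and-windowing operator is a linear map that acts on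
  each of the three indices separately. It sends an outer product to the outer product of the windowed
  vectors (\<open>window3_outer\<close>), so the sum over the \<open>L ^ 3\<close> lattice points of a windowed rank-one tensor
  factors, by multilinearity, into the outer product of three one-dimensional sums over \<open>L\<close> points
  each (\<open>assembled_outer\<close>). Applying this termwise keeps the number of terms of a canonical or Tucker
  sum (\<open>assembled_canonical\<close>, \<open>assembled_tucker\<close>), whatever \<open>L\<close> is. The cost is that of summing \<open>L\<close>
  numbers for every entry of every directional vector (\<open>compute_factors_eq\<close>).

  The assembled tensor represents the lattice sum because the lattice vectors are integer multiples of
  the mesh size. Translation by \<open>- b k\<close> carries the grid cells of the box to grid cells of the auxiliary
  box, with precisely the index shift of the windowing operator (\<open>basis3_shift\<close>). Translation
  invariance of Lebesgue measure then makes the projected tensor of a shifted potential a window of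
  the projected tensor of the centered one (\<open>box_tensor_shifted_potential\<close>). Windowing only selects
  entries, so it preserves the entrywise accuracy of the reference tensor, and the errors of the
  \<open>L ^ 3\<close> summands add up (\<open>represents_lattice_sum_assembled\<close>).
\<close>

section \<open>Algebra of the windowing operators\<close>

lemma sum_fun_apply: "(\<Sum>a\<in>A. f a) x = (\<Sum>a\<in>A. f a x)"
  for f :: "'a \<Rightarrow> 'b \<Rightarrow> 'c::comm_monoid_add"
  by (induction A rule: infinite_finite_induct) auto

definition window_index :: "nat \<Rightarrow> nat \<Rightarrow> int \<Rightarrow> nat \<Rightarrow> nat" where
  "window_index n L k i = nat (int i + int (n * L) div 2 - k * int n)"

lemma window_apply:
  "window n L k v i = (if i \<in> {1..n * L} then v (window_index n L k i) else 0)"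
  by (simp add: window_def window_index_def)

lemma window3_apply:
  "window3 n L k1 k2 k3 T i1 i2 i3 =
     (if i1 \<in> {1..n * L} \<and> i2 \<in> {1..n * L} \<and> i3 \<in> {1..n * L}
      then T (window_index n L k1 i1) (window_index n L k2 i2) (window_index n L k3 i3) else 0)"
  by (simp add: window3_def tensor_op_def window_apply)

lemma window3_outer:
  "window3 n L k1 k2 k3 (outer u v w) =
     outer (window n L k1 u) (window n L k2 v) (window n L k3 w)"
  by (intro ext) (auto simp: window3_apply outer_def window_apply)

lemma window3_tscale: "window3 n L k1 k2 k3 (tscale c T) = tscale c (window3 n L k1 k2 k3 T)"
  by (intro ext) (auto simp: window3_apply tscale_def)

lemma window3_sum: "window3 n L k1 k2 k3 (\<Sum>a\<in>A. T a) = (\<Sum>a\<in>A. window3 n L k1 k2 k3 (T a))"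
  by (intro ext) (auto simp: window3_apply sum_fun_apply)

lemma tscale_sum: "tscale c (\<Sum>a\<in>A. T a) = (\<Sum>a\<in>A. tscale c (T a))"
  by (intro ext) (auto simp: tscale_def sum_fun_apply sum_distrib_left)

lemma assembled_tscale: "assembled n L (tscale c T) = tscale c (assembled n L T)"
  by (simp add: assembled_def window3_tscale tscale_sum)

lemma assembled_sum: "assembled n L (\<Sum>a\<in>A. T a) = (\<Sum>a\<in>A. assembled n L (T a))"
  unfolding assembled_def window3_sum
  by (simp add: sum.swap[where B = A])

definition window_sum :: "nat \<Rightarrow> nat \<Rightarrow> rvector \<Rightarrow> rvector" where
  "window_sum n L v = (\<Sum>k\<in>lattice_index L. window n L k v)"

lemma window_sum_in_vectors: "window_sum n L v \<in> vectors (n * L)"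
  by (auto simp: window_sum_def vectors_def sum_fun_apply window_apply)

text \<open>
  Multilinearity of the outer product: the triple sum over the lattice of a product whose factors
  depend on one lattice index each is the product of three single sums. This is where the number of
  terms stops depending on \<open>L\<close>.
\<close>

lemma assembled_outer:
  "assembled n L (outer u v w) = outer (window_sum n L u) (window_sum n L v) (window_sum n L w)"
proof (intro ext)
  fix i1 i2 i3
  let ?K = "lattice_index L"
  let ?u = "\<lambda>k. window n L k u i1" and ?v = "\<lambda>k. window n L k v i2" and ?w = "\<lambda>k. window n L k w i3"
  have "assembled n L (outer u v w) i1 i2 i3 = (\<Sum>k1\<in>?K. \<Sum>k2\<in>?K. \<Sum>k3\<in>?K. ?u k1 * ?v k2 * ?w k3)"
    unfolding assembled_def window3_outer by (simp add: sum_fun_apply outer_def)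
  also have "\<dots> = (\<Sum>k1\<in>?K. ?u k1) * (\<Sum>k2\<in>?K. ?v k2) * (\<Sum>k3\<in>?K. ?w k3)"
    by (simp add: sum_distrib_left[symmetric] sum_distrib_right[symmetric])
  also have "\<dots> = outer (window_sum n L u) (window_sum n L v) (window_sum n L w) i1 i2 i3"
    by (simp add: outer_def window_sum_def sum_fun_apply)
  finally show "assembled n L (outer u v w) i1 i2 i3 =
    outer (window_sum n L u) (window_sum n L v) (window_sum n L w) i1 i2 i3" .
qed

lemma assembled_canonical:
  "assembled n L (canonical_sum R u v w) =
     canonical_sum R (\<lambda>q. window_sum n L (u q)) (\<lambda>q. window_sum n L (v q)) (\<lambda>q. window_sum n L (w q))"
  by (simp add: canonical_sum_def assembled_sum assembled_outer)

lemma assembled_tucker: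
  "assembled n L (tucker_sum r1 r2 r3 b u v w) =
     tucker_sum r1 r2 r3 b
       (\<lambda>m. window_sum n L (u m)) (\<lambda>m. window_sum n L (v m)) (\<lambda>m. window_sum n L (w m))"
  by (simp add: tucker_sum_def assembled_sum assembled_tscale assembled_outer)

lemma is_canonical_assembled: "is_canonical (n * L) R (assembled n L (canonical_sum R u v w))"
proof -
  have "\<forall>q\<in>{1..R}. window_sum n L (u q) \<in> vectors (n * L) \<and> window_sum n L (v q) \<in> vectors (n * L)
      \<and> window_sum n L (w q) \<in> vectors (n * L)"
    by (simp add: window_sum_in_vectors)
  then show ?thesis
    unfolding is_canonical_def assembled_canonical by fast
qed

lemma is_tucker_assembled:
  "is_tucker (n * L) r1 r2 r3 (assembled n L (tucker_sum r1 r2 r3 b u v w))"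
proof -
  have "\<forall>m\<in>{1..r}. window_sum n L (f m) \<in> vectors (n * L)" for r and f :: "nat \<Rightarrow> rvector"
    by (simp add: window_sum_in_vectors)
  then show ?thesis
    unfolding is_tucker_def assembled_tucker by fast
qed


section \<open>Projected tensors under lattice translations\<close>

lemma finite_lattice_index [simp]: "finite (lattice_index L)"
  by (simp add: lattice_index_def)

lemma card_lattice_index: "even L \<Longrightarrow> card (lattice_index L) = L"
  by (auto simp: lattice_index_def)

text \<open>
  On the relevant indices the truncation of negative integers and the integer division in the
  windowing operator have no effect, and the window stays within the auxiliary grid.
\<close>

lemma window_index_bounds:
  assumes "even L" "k \<in> lattice_index L" "i \<in> {1..n * L}"
  shows "window_index n L k i \<in> {1..2 * (n * L)}"
    and "real (window_index n L k i) = real i + real (n * L) / 2 - real_of_int k * real n"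
proof -
  obtain M where M: "L = 2 * M" using \<open>even L\<close> by (elim evenE)
  have half: "int (n * L) div 2 = int n * int M" by (simp add: M)
  have k: "- int M \<le> k" "k \<le> int M - 1" using assms(2) by (auto simp: lattice_index_def M)
  have "k * int n \<le> int M * int n" "- int M * int n \<le> k * int n"
    using k by (intro mult_right_mono; simp)+
  moreover have "int i \<le> int (n * L)"
    using assms(3) by (simp only: atLeastAtMost_iff of_nat_le_iff)
  moreover have "int (n * L) = 2 * (int n * int M)"
    by (simp add: M)
  ultimately have *: "1 \<le> int i + int n * int M - k * int n"
    "int i + int n * int M - k * int n \<le> int (2 * (n * L))"
    using assms(3) by (auto simp: algebra_simps)
  have eq: "int (window_index n L k i) = int i + int n * int M - k * int n"
    unfolding window_index_def half using * by simp
  show "window_index n L k i \<in> {1..2 * (n * L)}"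
    using * unfolding eq[symmetric] of_nat_le_iff by simp
  have "real (window_index n L k i) = real_of_int (int i + int n * int M - k * int n)"
    unfolding eq[symmetric] by simp
  then show "real (window_index n L k i) = real i + real (n * L) / 2 - real_of_int k * real n"
    by (simp add: M)
qed

lemma basis1_shift:
  assumes "a' - real j * h = a - real i * h + t"
  shows "basis1 a h i x = basis1 a' h j (x - t)"
  using assms by (auto simp: basis1_def indicator_def algebra_simps)

text \<open>The lattice vectors are integer multiples of \<open>h\<close>, so translated cells are grid cells again.\<close>

lemma basis3_shift:
  assumes "even L" "k1 \<in> lattice_index L" "k2 \<in> lattice_index L" "k3 \<in> lattice_index L"
    and "i1 \<in> {1..n * L}" "i2 \<in> {1..n * L}" "i3 \<in> {1..n * L}"
  shows "basis3 (real n * h * real L / 2) h i1 i2 i3 x =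
    basis3 (real n * h * real L) h (window_index n L k1 i1) (window_index n L k2 i2)
      (window_index n L k3 i3) (x - lattice_vector (real n * h) k1 k2 k3)"
proof -
  have cell: "basis1 (real n * h * real L / 2) h i y =
      basis1 (real n * h * real L) h (window_index n L k i) (y - real n * h * real_of_int k)"
    if "k \<in> lattice_index L" "i \<in> {1..n * L}" for k i y
    by (rule basis1_shift)
      (simp add: window_index_bounds(2)[OF \<open>even L\<close> that] field_simps)
  then show ?thesis
    unfolding basis3_def cell[OF assms(2,5)] cell[OF assms(3,6)] cell[OF assms(4,7)]
    by (simp add: lattice_vector_def vector_3)
qed

lemma basis3_eq_indicator:
  "basis3 a h i1 i2 i3 = indicator {x. x $ 1 \<in> {- a + (real i1 - 1) * h ..< - a + real i1 * h}
     \<and> x $ 2 \<in> {- a + (real i2 - 1) * h ..< - a + real i2 * h}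
     \<and> x $ 3 \<in> {- a + (real i3 - 1) * h ..< - a + real i3 * h}}"
  by (intro ext) (auto simp: basis3_def basis1_def indicator_def)

lemma integrable_basis3_mult:
  fixes f :: "real^3 \<Rightarrow> real"
  assumes "set_integrable lborel (centered_box a) f" "h > 0" "real N * h = 2 * a"
    and "i1 \<in> {1..N}" "i2 \<in> {1..N}" "i3 \<in> {1..N}"
  shows "integrable lborel (\<lambda>x. basis3 a h i1 i2 i3 x * f x)"
proof -
  define B :: "(real^3) set" where
    "B = {x. x $ 1 \<in> {- a + (real i1 - 1) * h ..< - a + real i1 * h}
     \<and> x $ 2 \<in> {- a + (real i2 - 1) * h ..< - a + real i2 * h}
     \<and> x $ 3 \<in> {- a + (real i3 - 1) * h ..< - a + real i3 * h}}"
  have [measurable]: "(\<lambda>x::real^3. x $ l) \<in> borel_measurable borel" for l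
    by (intro borel_measurable_continuous_onI continuous_intros)
  have "B \<in> sets lborel"
    unfolding B_def by measurable
  moreover have "B \<subseteq> centered_box a"
  proof -
    have "- a \<le> y \<and> y \<le> a"
      if "y \<in> {- a + (real i - 1) * h ..< - a + real i * h}" "i \<in> {1..N}" for i y
    proof -
      have "0 \<le> (real i - 1) * h" using that \<open>h > 0\<close> by simp
      moreover have "real i * h \<le> real N * h" using that \<open>h > 0\<close> by simp
      ultimately show ?thesis using that(1) assms(3) by auto
    qed
    then show ?thesis
      using assms(4-6) unfolding B_def centered_box_def by (auto simp: mem_box_cart forall_3)
  qed
  ultimately have "set_integrable lborel B f"
    using assms(1) by (rule set_integrable_subset[rotated])
  then show ?thesis
    unfolding set_integrable_def basis3_eq_indicator B_def[symmetric] by simp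
qed

lemma lborel_translation:
  fixes f :: "real^3 \<Rightarrow> real"
  assumes "integrable lborel f"
  shows "integrable lborel (\<lambda>x. f (x - t))"
    and "(\<integral>x. f (x - t) \<partial>lborel) = (\<integral>x. f x \<partial>lborel)"
proof -
  have f: "f \<in> borel_measurable borel" using borel_measurable_integrable[OF assms] by simp
  have distr: "distr lborel borel (\<lambda>x. x - t) = lborel"
    using lborel_distr_plus[of "- t"] by (metis (no_types, lifting) ext diff_conv_add_uminus add.commute)
  show "integrable lborel (\<lambda>x. f (x - t))" "(\<integral>x. f (x - t) \<partial>lborel) = (\<integral>x. f x \<partial>lborel)"
    using assms f integrable_distr_eq[of "\<lambda>x. x - t" lborel borel f]
      integral_distr[of "\<lambda>x. x - t" lborel borel f]
    by (simp_all add: distr)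
qed

text \<open>
  A window selects entries of its argument within the auxiliary grid, so the maximum norm of the error
  does not increase.
\<close>

lemma approximates_window3:
  assumes "approximates (2 * (n * L)) \<epsilon> S T" "even L"
    and "k1 \<in> lattice_index L" "k2 \<in> lattice_index L" "k3 \<in> lattice_index L"
  shows "approximates (n * L) \<epsilon> (window3 n L k1 k2 k3 S) (window3 n L k1 k2 k3 T)"
  unfolding approximates_def
proof (intro ballI)
  fix i1 i2 i3
  assume i: "i1 \<in> {1..n * L}" "i2 \<in> {1..n * L}" "i3 \<in> {1..n * L}"
  have "window_index n L k1 i1 \<in> {1..2 * (n * L)}" "window_index n L k2 i2 \<in> {1..2 * (n * L)}"
    "window_index n L k3 i3 \<in> {1..2 * (n * L)}"
    using window_index_bounds(1)[OF \<open>even L\<close>] assms(3-5) i by blast+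
  then show "\<bar>window3 n L k1 k2 k3 S i1 i2 i3 - window3 n L k1 k2 k3 T i1 i2 i3\<bar> \<le> \<epsilon>"
    using assms(1) i unfolding approximates_def window3_apply by simp
qed

lemma approximates_sum:
  assumes "\<And>a. a \<in> A \<Longrightarrow> approximates N \<epsilon> (S a) (T a)"
  shows "approximates N (real (card A) * \<epsilon>) (\<Sum>a\<in>A. S a) (\<Sum>a\<in>A. T a)"
  unfolding approximates_def sum_fun_apply sum_subtractf[symmetric]
  using assms by (auto simp: approximates_def intro!: order.trans[OF sum_abs] sum_bounded_above)

context
  fixes p :: "real \<Rightarrow> real" and n L :: nat and h :: real
  assumes setting: "lattice_setting p n h L"
begin

lemma even_L: "even L"
  using setting by (simp add: lattice_setting_def)

text \<open>The change of variables \<open>x \<mapsto> x - b k\<close> in the integral that defines an entry.\<close>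

lemma shifted_potential_projection:
  assumes "k1 \<in> lattice_index L" "k2 \<in> lattice_index L" "k3 \<in> lattice_index L"
    and "i1 \<in> {1..n * L}" "i2 \<in> {1..n * L}" "i3 \<in> {1..n * L}"
  defines "g \<equiv> \<lambda>x. basis3 (real n * h * real L / 2) h i1 i2 i3 x
     * shifted_potential p (real n * h) k1 k2 k3 x"
  shows "integrable lborel g"
    and "(\<integral>x. g x \<partial>lborel) = aux_box_tensor n h L (\<lambda>x. p (norm x))
           (window_index n L k1 i1) (window_index n L k2 i2) (window_index n L k3 i3)"
proof -
  let ?j1 = "window_index n L k1 i1" and ?j2 = "window_index n L k2 i2"
    and ?j3 = "window_index n L k3 i3"
  let ?f = "\<lambda>x. basis3 (real n * h * real L) h ?j1 ?j2 ?j3 x * p (norm x)"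
  have j: "?j1 \<in> {1..2 * (n * L)}" "?j2 \<in> {1..2 * (n * L)}" "?j3 \<in> {1..2 * (n * L)}"
    using window_index_bounds(1)[OF even_L] assms(1-6) by blast+
  have g: "g = (\<lambda>x. ?f (x - lattice_vector (real n * h) k1 k2 k3))"
    unfolding g_def shifted_potential_def using basis3_shift[OF even_L assms(1-6)] by simp
  have f: "integrable lborel ?f"
    using setting j by (intro integrable_basis3_mult[where N = "2 * (n * L)"])
      (auto simp: lattice_setting_def)
  show "integrable lborel g" unfolding g by (rule lborel_translation(1)[OF f])
  have "(\<integral>x. g x \<partial>lborel) = (\<integral>x. ?f x \<partial>lborel)" unfolding g by (rule lborel_translation(2)[OF f])
  also have "\<dots> = aux_box_tensor n h L (\<lambda>x. p (norm x)) ?j1 ?j2 ?j3"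
    using j by (simp add: aux_box_tensor_def projected_tensor_def)
  finally show "(\<integral>x. g x \<partial>lborel) = aux_box_tensor n h L (\<lambda>x. p (norm x)) ?j1 ?j2 ?j3" .
qed

lemma box_tensor_shifted_potential:
  assumes "k1 \<in> lattice_index L" "k2 \<in> lattice_index L" "k3 \<in> lattice_index L"
  shows "box_tensor n h L (shifted_potential p (real n * h) k1 k2 k3) =
    window3 n L k1 k2 k3 (aux_box_tensor n h L (\<lambda>x. p (norm x)))"
  by (intro ext)
    (simp add: box_tensor_def projected_tensor_def window3_apply shifted_potential_projection(2) assms)

lemma box_tensor_lattice_potential:
  "box_tensor n h L (lattice_potential p (real n * h) L) =
     (\<Sum>k1\<in>lattice_index L. \<Sum>k2\<in>lattice_index L. \<Sum>k3\<in>lattice_index L.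
        box_tensor n h L (shifted_potential p (real n * h) k1 k2 k3))"
proof (intro ext)
  fix i1 i2 i3
  show "box_tensor n h L (lattice_potential p (real n * h) L) i1 i2 i3 =
     (\<Sum>k1\<in>lattice_index L. \<Sum>k2\<in>lattice_index L. \<Sum>k3\<in>lattice_index L.
        box_tensor n h L (shifted_potential p (real n * h) k1 k2 k3)) i1 i2 i3"
    by (cases "i1 \<in> {1..n * L} \<and> i2 \<in> {1..n * L} \<and> i3 \<in> {1..n * L}")
      (simp_all only: box_tensor_def projected_tensor_def lattice_potential_def sum_fun_apply
        sum_distrib_left shifted_potential_projection(1) if_True if_False sum.neutral_const
        Bochner_Integration.integral_sum Bochner_Integration.integrable_sum simp_thms cong: sum.cong)
qed

lemma represents_lattice_sum_assembled:
  assumes S: "approximates (2 * (n * L)) \<epsilon> S (aux_box_tensor n h L (\<lambda>x. p (norm x)))"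
  shows "represents_lattice_sum p n h L \<epsilon> S (assembled n L S)"
proof -
  let ?K = "lattice_index L"
  have appr: "approximates (n * L) \<epsilon> (window3 n L k1 k2 k3 S)
      (box_tensor n h L (shifted_potential p (real n * h) k1 k2 k3))"
    if "k1 \<in> ?K" "k2 \<in> ?K" "k3 \<in> ?K" for k1 k2 k3
    unfolding box_tensor_shifted_potential[OF that] by (rule approximates_window3[OF S even_L that])
  have card: "card ?K = L" by (rule card_lattice_index[OF even_L])
  have "approximates (n * L) (real (card ?K) * (real (card ?K) * (real (card ?K) * \<epsilon>)))
      (assembled n L S) (box_tensor n h L (lattice_potential p (real n * h) L))"
    unfolding assembled_def box_tensor_lattice_potential by (intro approximates_sum appr)
  then have "approximates (n * L) (real L ^ 3 * \<epsilon>) (assembled n L S)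
      (box_tensor n h L (lattice_potential p (real n * h) L))"
    unfolding card by (simp add: power3_eq_cube mult.assoc)
  then show ?thesis
    unfolding represents_lattice_sum_def
    using appr box_tensor_shifted_potential box_tensor_lattice_potential by blast
qed

end

section \<open>Computation of the directional vectors\<close>

lemma csum_eq: "csum xs = (sum_list xs, length xs)"
  by (induction xs) (auto simp: creturn_def cbind_def cadd_def)

lemma cmap_eq: "cmap f xs = (map (\<lambda>x. fst (f x)) xs, \<Sum>x\<leftarrow>xs. snd (f x))"
  by (induction xs) (auto simp: creturn_def cbind_def)

lemma compute_window_sum_eq:
  assumes "even L"
  shows "compute_window_sum n L v = (map (window_sum n L v) [1..<n * L + 1], n * L * L)"
proof -
  let ?ks = "[- (int L div 2) .. int L div 2 - 1]"
  have ks: "set ?ks = lattice_index L" by (simp add: lattice_index_def)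
  have "length ?ks = L" using assms by auto
  moreover have "(\<Sum>k\<leftarrow>?ks. window n L k v i) = window_sum n L v i" for i
    by (simp add: sum_list_distinct_conv_sum_set ks window_sum_def sum_fun_apply del: set_upto)
  ultimately show ?thesis
    unfolding compute_window_sum_def cmap_eq csum_eq
    by (simp add: sum_list_triv del: length_upto upt_Suc)
qed

lemma compute_factors_eq:
  assumes "even L"
  shows "compute_factors n L r1 r2 r3 u v w =
    ((map (\<lambda>m. map (window_sum n L (u m)) [1..<n * L + 1]) [1..<r1 + 1],
      map (\<lambda>m. map (window_sum n L (v m)) [1..<n * L + 1]) [1..<r2 + 1],
      map (\<lambda>m. map (window_sum n L (w m)) [1..<n * L + 1]) [1..<r3 + 1]),
     (r1 + r2 + r3) * (n * L * L))"
  unfolding compute_factors_def compute_window_sum_eq[OF assms] cmap_eq cbind_def creturn_def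
  by (simp add: sum_list_triv algebra_simps del: upt_Suc)

lemma vector_of_map: "v \<in> vectors N \<Longrightarrow> vector_of (map v [1..<N + 1]) = v"
  by (intro ext) (auto simp: vector_of_def vectors_def simp del: upt_Suc)

lemma factor_of_window_sums:
  assumes "m \<in> {1..r}"
  shows "factor_of (map (\<lambda>m. map (window_sum n L (u m)) [1..<n * L + 1]) [1..<r + 1]) m =
    window_sum n L (u m)"
proof -
  have "m - 1 < length [1..<r + 1]" "[1..<r + 1] ! (m - 1) = m"
    using assms by (auto simp del: upt_Suc)
  then show ?thesis
    unfolding factor_of_def by (simp only: nth_map vector_of_map[OF window_sum_in_vectors])
qed

text \<open>
  Each of the \<open>r1 + r2 + r3\<close> directional vectors has \<open>n L\<close> entries, and each entry is a
  sum of \<open>L\<close> numbers, accumulated from zero and hence with \<open>L\<close> additions.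
\<close>

lemma compute_factors_correct:
  assumes "even L" "compute_factors n L r1 r2 r3 u v w = (F, cost)"
  shows "number_of_factors F = (r1, r2, r3)"
    and "cost = (r1 + r2 + r3) * L * (n * L)"
    and "factor_storage F = (r1 + r2 + r3) * (n * L)"
    and "tucker_value r1 r2 r3 b F = assembled n L (tucker_sum r1 r2 r3 b u v w)"
    and "r1 = R \<Longrightarrow> r2 = R \<Longrightarrow> r3 = R \<Longrightarrow>
      canonical_value R F = assembled n L (canonical_sum R u v w)"
proof -
  note F = compute_factors_eq[OF assms(1), of n r1 r2 r3 u v w, unfolded assms(2), simplified prod.inject]
  show "number_of_factors F = (r1, r2, r3)"
    using F by (simp add: number_of_factors_def del: upt_Suc)
  show "cost = (r1 + r2 + r3) * L * (n * L)" using F by (simp add: algebra_simps)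
  show "factor_storage F = (r1 + r2 + r3) * (n * L)"
    using F by (simp add: factor_storage_def comp_def sum_list_triv algebra_simps del: upt_Suc)
  show "tucker_value r1 r2 r3 b F = assembled n L (tucker_sum r1 r2 r3 b u v w)"
    unfolding assembled_tucker
    unfolding tucker_sum_def tucker_value_def F[THEN conjunct1] prod.case
    by (intro sum.cong refl) (simp only: factor_of_window_sums)
  show "canonical_value R F = assembled n L (canonical_sum R u v w)"
    if "r1 = R" "r2 = R" "r3 = R"
    unfolding assembled_canonical
    unfolding canonical_sum_def canonical_value_def F[THEN conjunct1] prod.case that
    by (intro sum.cong refl) (simp only: factor_of_window_sums)
qed

text \<open>
  The core has at most \<open>r ^ 3 = r * r ^ 2\<close> coefficients, and the bound on \<open>r ^ 2\<close> turns this into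
  \<open>c * r * N\<close>, the order of magnitude of the storage of the directional vectors.
\<close>

lemma tucker_storage_le:
  fixes c :: real
  assumes F: "factor_storage F = (r1 + r2 + r3) * N"
    and "r1 \<le> r" "r2 \<le> r" "r3 \<le> r" "c \<ge> 0" "real r ^ 2 \<le> c * real N"
  shows "real (tucker_storage r1 r2 r3 F) \<le> (1 + c) * (3 * real r * real N)"
proof -
  have "r1 * r2 * r3 \<le> r * r * r" using assms by (intro mult_mono) auto
  then have "real (r1 * r2 * r3) \<le> real r * real r ^ 2"
    by (metis of_nat_le_iff of_nat_mult power2_eq_square mult.assoc)
  also have "\<dots> \<le> real r * (c * real N)" using assms by (intro mult_left_mono) auto
  also have "\<dots> \<le> 3 * (real r * (c * real N))" using assms by simp
  finally have core: "real (r1 * r2 * r3) \<le> 3 * (real r * (c * real N))" .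
  have "(r1 + r2 + r3) * N \<le> (3 * r) * N" using assms by (intro mult_right_mono) auto
  then have "real ((r1 + r2 + r3) * N) \<le> 3 * real r * real N"
    by (metis of_nat_le_iff of_nat_mult of_nat_numeral)
  with core show ?thesis
    unfolding tucker_storage_def F by (simp add: algebra_simps)
qed


section \<open>The assembled lattice sum\<close>

theorem theorem3p2:
  shows
  "(\<exists>C::real. \<forall>(p::real \<Rightarrow> real) (n::nat) (h::real) (L::nat) (R::nat)
        (p1::nat \<Rightarrow> rvector) (p2::nat \<Rightarrow> rvector) (p3::nat \<Rightarrow> rvector) (P::tensor3) (\<epsilon>::real).
      lattice_setting p n h L \<and>
      (\<forall>q\<in>{1..R}. p1 q \<in> vectors (2 * (n * L)) \<and> p2 q \<in> vectors (2 * (n * L))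
                  \<and> p3 q \<in> vectors (2 * (n * L))) \<and>
      P = (\<Sum>q=1..R. outer (p1 q) (p2 q) (p3 q)) \<and>
      approximates (2 * (n * L)) \<epsilon> P (aux_box_tensor n h L (\<lambda>x. p (norm x)))
      \<longrightarrow>
      represents_lattice_sum p n h L \<epsilon> P (assembled n L P) \<and>
      is_canonical (n * L) R (assembled n L P) \<and>
      (\<Sum>k1\<in>lattice_index L. \<Sum>k2\<in>lattice_index L. \<Sum>k3\<in>lattice_index L. window3 n L k1 k2 k3 P) =
        (\<Sum>q=1..R. outer (\<Sum>k1\<in>lattice_index L. window n L k1 (p1 q))
                          (\<Sum>k2\<in>lattice_index L. window n L k2 (p2 q))
                          (\<Sum>k3\<in>lattice_index L. window n L k3 (p3 q))) \<and>
      (case compute_factors n L R R R p1 p2 p3 of (F, cost) \<Rightarrow>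
         number_of_factors F = (R, R, R) \<and>
         canonical_value R F = assembled n L P \<and>
         real cost \<le> C * (real R * real L * real (n * L)) \<and>
         real (factor_storage F) \<le> C * (real R * real (n * L))))
   \<and>
   (\<exists>C::real. \<forall>(p::real \<Rightarrow> real) (n::nat) (h::real) (L::nat) (r1::nat) (r2::nat) (r3::nat) (b::tensor3)
        (t1::nat \<Rightarrow> rvector) (t2::nat \<Rightarrow> rvector) (t3::nat \<Rightarrow> rvector) (T::tensor3) (\<epsilon>::real).
      lattice_setting p n h L \<and>
      (\<forall>m\<in>{1..r1}. t1 m \<in> vectors (2 * (n * L))) \<and>
      (\<forall>m\<in>{1..r2}. t2 m \<in> vectors (2 * (n * L))) \<and>
      (\<forall>m\<in>{1..r3}. t3 m \<in> vectors (2 * (n * L))) \<and>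
      T = (\<Sum>m1=1..r1. \<Sum>m2=1..r2. \<Sum>m3=1..r3.
             tscale (b m1 m2 m3) (outer (t1 m1) (t2 m2) (t3 m3))) \<and>
      approximates (2 * (n * L)) \<epsilon> T (aux_box_tensor n h L (\<lambda>x. p (norm x)))
      \<longrightarrow>
      represents_lattice_sum p n h L \<epsilon> T (assembled n L T) \<and>
      is_tucker (n * L) r1 r2 r3 (assembled n L T) \<and>
      (\<Sum>k1\<in>lattice_index L. \<Sum>k2\<in>lattice_index L. \<Sum>k3\<in>lattice_index L. window3 n L k1 k2 k3 T) =
        (\<Sum>m1=1..r1. \<Sum>m2=1..r2. \<Sum>m3=1..r3.
           tscale (b m1 m2 m3)
             (outer (\<Sum>k1\<in>lattice_index L. window n L k1 (t1 m1))
                    (\<Sum>k2\<in>lattice_index L. window n L k2 (t2 m2))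
                    (\<Sum>k3\<in>lattice_index L. window n L k3 (t3 m3)))) \<and>
      (case compute_factors n L r1 r2 r3 t1 t2 t3 of (F, cost) \<Rightarrow>
         number_of_factors F = (r1, r2, r3) \<and>
         tucker_value r1 r2 r3 b F = assembled n L T \<and>
         real cost \<le> C * (3 * real (max r1 (max r2 r3)) * real L * real (n * L)) \<and>
         real (factor_storage F) \<le> C * (3 * real (max r1 (max r2 r3)) * real (n * L)) \<and>
         (\<forall>c\<ge>0. real (max r1 (max r2 r3)) ^ 2 \<le> c * real (n * L) \<longrightarrow>
            real (tucker_storage r1 r2 r3 F)
              \<le> C * (1 + c) * (3 * real (max r1 (max r2 r3)) * real (n * L)))))"
proof (intro conjI exI allI impI)
  fix p :: "real \<Rightarrow> real" and n :: nat and h :: real and L R :: nat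
    and p1 p2 p3 :: "nat \<Rightarrow> rvector" and P :: tensor3 and \<epsilon> :: real
  assume A: "lattice_setting p n h L \<and>
      (\<forall>q\<in>{1..R}. p1 q \<in> vectors (2 * (n * L)) \<and> p2 q \<in> vectors (2 * (n * L))
                  \<and> p3 q \<in> vectors (2 * (n * L))) \<and>
      P = (\<Sum>q=1..R. outer (p1 q) (p2 q) (p3 q)) \<and>
      approximates (2 * (n * L)) \<epsilon> P (aux_box_tensor n h L (\<lambda>x. p (norm x)))"
  then have L: "even L" by (simp add: lattice_setting_def)
  have P: "P = canonical_sum R p1 p2 p3" using A by (simp add: canonical_sum_def)
  show "represents_lattice_sum p n h L \<epsilon> P (assembled n L P)"
    using A by (intro represents_lattice_sum_assembled) blast+
  show "is_canonical (n * L) R (assembled n L P)"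
    unfolding P by (rule is_canonical_assembled)
  show "(\<Sum>k1\<in>lattice_index L. \<Sum>k2\<in>lattice_index L. \<Sum>k3\<in>lattice_index L. window3 n L k1 k2 k3 P) =
        (\<Sum>q=1..R. outer (\<Sum>k1\<in>lattice_index L. window n L k1 (p1 q))
                          (\<Sum>k2\<in>lattice_index L. window n L k2 (p2 q))
                          (\<Sum>k3\<in>lattice_index L. window n L k3 (p3 q)))"
    using assembled_canonical[of n L R p1 p2 p3]
    unfolding P[symmetric] by (simp add: assembled_def canonical_sum_def window_sum_def)
  obtain F cost where Fc: "compute_factors n L R R R p1 p2 p3 = (F, cost)" by fastforce
  note C = compute_factors_correct[OF L Fc]
  \<comment> \<open>Here the constant is 3: there are \<open>R\<close> vectors in each of the three directions.\<close>
  show "case compute_factors n L R R R p1 p2 p3 of (F, cost) \<Rightarrow>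
         number_of_factors F = (R, R, R) \<and>
         canonical_value R F = assembled n L P \<and>
         real cost \<le> 3 * (real R * real L * real (n * L)) \<and>
         real (factor_storage F) \<le> 3 * (real R * real (n * L))"
    using C(1,5) unfolding Fc P by (simp add: C(2,3) algebra_simps)
next
  fix p :: "real \<Rightarrow> real" and n :: nat and h :: real and L r1 r2 r3 :: nat and b :: tensor3
    and t1 t2 t3 :: "nat \<Rightarrow> rvector" and T :: tensor3 and \<epsilon> :: real
  assume A: "lattice_setting p n h L \<and>
      (\<forall>m\<in>{1..r1}. t1 m \<in> vectors (2 * (n * L))) \<and>
      (\<forall>m\<in>{1..r2}. t2 m \<in> vectors (2 * (n * L))) \<and>
      (\<forall>m\<in>{1..r3}. t3 m \<in> vectors (2 * (n * L))) \<and>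
      T = (\<Sum>m1=1..r1. \<Sum>m2=1..r2. \<Sum>m3=1..r3.
             tscale (b m1 m2 m3) (outer (t1 m1) (t2 m2) (t3 m3))) \<and>
      approximates (2 * (n * L)) \<epsilon> T (aux_box_tensor n h L (\<lambda>x. p (norm x)))"
  then have L: "even L" by (simp add: lattice_setting_def)
  have T: "T = tucker_sum r1 r2 r3 b t1 t2 t3" using A by (simp add: tucker_sum_def)
  show "represents_lattice_sum p n h L \<epsilon> T (assembled n L T)"
    using A by (intro represents_lattice_sum_assembled) blast+
  show "is_tucker (n * L) r1 r2 r3 (assembled n L T)"
    unfolding T by (rule is_tucker_assembled)
  show "(\<Sum>k1\<in>lattice_index L. \<Sum>k2\<in>lattice_index L. \<Sum>k3\<in>lattice_index L. window3 n L k1 k2 k3 T) =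
        (\<Sum>m1=1..r1. \<Sum>m2=1..r2. \<Sum>m3=1..r3.
           tscale (b m1 m2 m3)
             (outer (\<Sum>k1\<in>lattice_index L. window n L k1 (t1 m1))
                    (\<Sum>k2\<in>lattice_index L. window n L k2 (t2 m2))
                    (\<Sum>k3\<in>lattice_index L. window n L k3 (t3 m3))))"
    using assembled_tucker[of n L r1 r2 r3 b t1 t2 t3]
    unfolding T[symmetric] by (simp add: assembled_def tucker_sum_def window_sum_def)
  obtain F cost where Fc: "compute_factors n L r1 r2 r3 t1 t2 t3 = (F, cost)" by fastforce
  note C = compute_factors_correct[OF L Fc]
  let ?r = "max r1 (max r2 r3)"
  \<comment> \<open>The bounds carry the factor 3 for the directions themselves, so the constant is 1.\<close>
  have sum_le: "real (r1 + r2 + r3) \<le> 3 * real ?r" by linarith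
  have "real cost \<le> 3 * real ?r * real L * real (n * L)"
    unfolding C(2) of_nat_mult[of "(r1 + r2 + r3) * L"] of_nat_mult[of "r1 + r2 + r3"]
    by (intro mult_right_mono sum_le) auto
  moreover have "real (factor_storage F) \<le> 3 * real ?r * real (n * L)"
    unfolding C(3) of_nat_mult[of "r1 + r2 + r3"] by (intro mult_right_mono sum_le) auto
  moreover have "real (tucker_storage r1 r2 r3 F) \<le> (1 + c) * (3 * real ?r * real (n * L))"
    if "c \<ge> 0" "real ?r ^ 2 \<le> c * real (n * L)" for c
    by (rule tucker_storage_le[OF C(3) _ _ _ that]) auto
  ultimately show "case compute_factors n L r1 r2 r3 t1 t2 t3 of (F, cost) \<Rightarrow>
         number_of_factors F = (r1, r2, r3) \<and>
         tucker_value r1 r2 r3 b F = assembled n L T \<and>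
         real cost \<le> 1 * (3 * real ?r * real L * real (n * L)) \<and>
         real (factor_storage F) \<le> 1 * (3 * real ?r * real (n * L)) \<and>
         (\<forall>c\<ge>0. real ?r ^ 2 \<le> c * real (n * L) \<longrightarrow>
            real (tucker_storage r1 r2 r3 F)
              \<le> 1 * (1 + c) * (3 * real ?r * real (n * L)))"
    using C(1,4) unfolding Fc T prod.case mult_1_left by blast
qed

end
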